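(* Let $G$ be a group with a finite symmetric generating set $A$. Then $G$ is stackable with respect to $A$ if and only if the Cayley graph $\Gamma(G,A)$ admits a bounded flow function (i.e. there are a maximal tree $T$ in $\Gamma(G,A)$ and a bounded flow function associated to $T$).
   Context: Conventions. A finite generating set $A$ of a group $G$ is symmetric if it is closed under inversion; for $a\in A$, $a^{-1}\in A$ denotes the inverse letter. Standing assumption: no element of $A$ represents the identity of $G$. $A^*$ is the set of words over $A$. Let $\Gamma=\Gamma(G,A)$ be the Cayley graph, $\vec E$ its set of directed edges, and $\vec P$ its set of directed edge paths. For $g\in G$, $a\in A$, let $e_{g,a}\in\vec E$ be the directed edge with initial vertex $g$, terminal vertex $ga$ and label $a$. The directed edges $e_{g,a}$ and $e_{ga,a^{-1}}$ are viewed as having a single underlying undirected edge. The edges lying on a directed path are taken with the direction in which the path traverses them. Normal forms. A set of normal forms for $G$ over $A$ is a subset $\mathcal N\subset A^*$ such that the canonical map $A^*\to G$ restricts to a bijection $\mathcal N\to G$; $y_g\in\mathcal N$ denotes the normal form of $g\in G$. The edge $e_{g,a}$ is degenerate if $y_ga=y_{ga}$ or $y_g=y_{ga}a^{-1}$ as words. Let $\vec E_d$ be the set of degenerate edges and $\vec E_r=\vec E\setminus\vec E_d$ (recursive edges). Stackable. $G$ is stackable with respect to $A$ if there exist a set $\mathcal N$ of normal forms for $G$ over $A$ containing the empty word, a well-founded strict partial ordering $<$ on $\vec E_r$, and a constant $k$, such that for every $g\in G$ and $a\in A$ there is a path $p$ from $g$ to $ga$ in $\Gamma$ of length at most $k$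 such that whenever $e'$ is a directed edge in the path $p$, either $e',e_{g,a}\in\vec E_r$ and $e'<e_{g,a}$, or else $e'\in\vec E_d$. Flow function. A flow function associated to a maximal tree $T$ in $\Gamma$ is a function $\Phi:\vec E\to\vec P$ such that: (F1) for each $e\in\vec E$, the path $\Phi(e)$ has the same initial and terminal vertices as $e$; (F2d) if the undirected edge underlying $e$ lies in $T$, then $\Phi(e)=e$; (F2r) the transitive closure $<_\Phi$ of the relation $<$ on $\vec E$ defined by "$e'<e$ whenever $e'$ lies on the path $\Phi(e)$ and the undirected edges underlying both $e$ and $e'$ do not lie in $T$" is a well-founded strict partial ordering. A flow function is bounded if there is a constant $k$ such that for all $e\in\vec E$ the path $\Phi(e)$ has length at most $k$. *)

theory Defs
  imports "HOL-Algebra.Generated_Groups" "Graph_Theory.Digraph_Component"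
begin

definition symmetric_generating_set :: "('a, 'm) monoid_scheme \<Rightarrow> 'a set \<Rightarrow> bool" where
  "symmetric_generating_set G A \<longleftrightarrow>
     A \<subseteq> carrier G \<and> generate G A = carrier G \<and> (\<forall>a\<in>A. inv\<^bsub>G\<^esub> a \<in> A)"

text \<open>The pair \<open>(g, a)\<close> is the directed edge from \<open>g\<close> to \<open>ga\<close> labelled \<open>a\<close>. The library's arc
  walks of this digraph are the directed edge paths.\<close>

definition cayley_graph :: "('a, 'm) monoid_scheme \<Rightarrow> 'a set \<Rightarrow> ('a, 'a \<times> 'a) pre_digraph" where
  "cayley_graph G A =
     \<lparr>verts = carrier G, arcs = carrier G \<times> A, tail = fst, head = (\<lambda>(g, a). g \<otimes>\<^bsub>G\<^esub> a)\<rparr>"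

definition edge_inv :: "('a, 'm) monoid_scheme \<Rightarrow> 'a \<times> 'a \<Rightarrow> 'a \<times> 'a" where
  "edge_inv G = (\<lambda>(g, a). (g \<otimes>\<^bsub>G\<^esub> a, inv\<^bsub>G\<^esub> a))"

abbreviation is_path :: "('a, 'm) monoid_scheme \<Rightarrow> 'a set \<Rightarrow> 'a \<Rightarrow> ('a \<times> 'a) list \<Rightarrow> 'a \<Rightarrow> bool" where
  "is_path G A \<equiv> pre_digraph.awalk (cayley_graph G A)"

definition wf_strict_order_on :: "'e set \<Rightarrow> ('e \<times> 'e) set \<Rightarrow> bool" where
  "wf_strict_order_on E r \<longleftrightarrow> r \<subseteq> E \<times> E \<and> irrefl r \<and> trans r \<and> wf r"


section \<open>Stackable groups\<close>

definition word_eval :: "('a, 'm) monoid_scheme \<Rightarrow> 'a list \<Rightarrow> 'a" where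
  "word_eval G w = foldr (\<otimes>\<^bsub>G\<^esub>) w \<one>\<^bsub>G\<^esub>"

definition normal_forms :: "('a, 'm) monoid_scheme \<Rightarrow> 'a set \<Rightarrow> 'a list set \<Rightarrow> bool" where
  "normal_forms G A N \<longleftrightarrow> N \<subseteq> lists A \<and> bij_betw (word_eval G) N (carrier G)"

definition nf :: "('a, 'm) monoid_scheme \<Rightarrow> 'a list set \<Rightarrow> 'a \<Rightarrow> 'a list" where
  "nf G N = the_inv_into N (word_eval G)"

definition degenerate_edges ::
  "('a, 'm) monoid_scheme \<Rightarrow> 'a set \<Rightarrow> 'a list set \<Rightarrow> ('a \<times> 'a) set" where
  "degenerate_edges G A N =
     {(g, a) \<in> arcs (cayley_graph G A).
        nf G N g @ [a] = nf G N (g \<otimes>\<^bsub>G\<^esub> a) \<or> nf G N g = nf G N (g \<otimes>\<^bsub>G\<^esub> a) @ [inv\<^bsub>G\<^esub> a]}"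

definition recursive_edges ::
  "('a, 'm) monoid_scheme \<Rightarrow> 'a set \<Rightarrow> 'a list set \<Rightarrow> ('a \<times> 'a) set" where
  "recursive_edges G A N = arcs (cayley_graph G A) - degenerate_edges G A N"

definition stackable :: "('a, 'm) monoid_scheme \<Rightarrow> 'a set \<Rightarrow> bool" where
  "stackable G A \<longleftrightarrow>
     (\<exists>N r (k::nat). normal_forms G A N \<and> [] \<in> N \<and>
        wf_strict_order_on (recursive_edges G A N) r \<and>
        (\<forall>g\<in>carrier G. \<forall>a\<in>A. \<exists>p. is_path G A g p (g \<otimes>\<^bsub>G\<^esub> a) \<and> length p \<le> k \<and>
           (\<forall>e'\<in>set p.
              (e' \<in> recursive_edges G A N \<and> (g, a) \<in> recursive_edges G A N \<and> (e', (g, a)) \<in> r) \<or>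
              e' \<in> degenerate_edges G A N)))"


section \<open>Flow functions\<close>

text \<open>
  An undirected subgraph is a sub-digraph whose arcs are closed under \<open>edge_inv\<close>; the undirected edge
  underlying \<open>e\<close> lies in it iff \<open>e\<close> is one of its arcs. The library's \<open>tree\<close> is not usable here: it
  asks for the absence of directed cycles, and every edge followed by its inverse is one. A circuit
  is therefore a cycle that does not traverse an edge in both directions.
\<close>

definition circuit ::
  "('a, 'm) monoid_scheme \<Rightarrow> ('a, 'a \<times> 'a) pre_digraph \<Rightarrow> ('a \<times> 'a) list \<Rightarrow> bool" where
  "circuit G H p \<longleftrightarrow> pre_digraph.cycle H p \<and> (\<forall>e\<in>set p. edge_inv G e \<notin> set p)"

definition undirected_tree ::
  "('a, 'm) monoid_scheme \<Rightarrow> ('a, 'a \<times> 'a) pre_digraph \<Rightarrow> bool" where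
  "undirected_tree G H \<longleftrightarrow>
     edge_inv G ` arcs H \<subseteq> arcs H \<and> Digraph_Component.connected H \<and> (\<nexists>p. circuit G H p)"

definition maximal_tree ::
  "('a, 'm) monoid_scheme \<Rightarrow> 'a set \<Rightarrow> ('a, 'a \<times> 'a) pre_digraph \<Rightarrow> bool" where
  "maximal_tree G A T \<longleftrightarrow> pre_digraph.max_subgraph (cayley_graph G A) (undirected_tree G) T"

definition flow_less :: "('a, 'm) monoid_scheme \<Rightarrow> 'a set \<Rightarrow> ('a, 'a \<times> 'a) pre_digraph \<Rightarrow>
    ('a \<times> 'a \<Rightarrow> ('a \<times> 'a) list) \<Rightarrow> (('a \<times> 'a) \<times> ('a \<times> 'a)) set" where
  "flow_less G A T \<Phi> =
     {(e', e). e \<in> arcs (cayley_graph G A) \<and> e' \<in> set (\<Phi> e) \<and> e \<notin> arcs T \<and> e' \<notin> arcs T}\<^sup>+"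

text \<open>Only the values of \<open>\<Phi>\<close> on the edges of the Cayley graph matter.\<close>

definition flow_function :: "('a, 'm) monoid_scheme \<Rightarrow> 'a set \<Rightarrow> ('a, 'a \<times> 'a) pre_digraph \<Rightarrow>
    ('a \<times> 'a \<Rightarrow> ('a \<times> 'a) list) \<Rightarrow> bool" where
  "flow_function G A T \<Phi> \<longleftrightarrow>
     (\<forall>e\<in>arcs (cayley_graph G A).
        is_path G A (tail (cayley_graph G A) e) (\<Phi> e) (head (cayley_graph G A) e)) \<and>
     (\<forall>e\<in>arcs (cayley_graph G A). e \<in> arcs T \<longrightarrow> \<Phi> e = [e]) \<and>
     wf_strict_order_on (arcs (cayley_graph G A)) (flow_less G A T \<Phi>)"

definition bounded_flow :: "('a, 'm) monoid_scheme \<Rightarrow> 'a set \<Rightarrow>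
    ('a \<times> 'a \<Rightarrow> ('a \<times> 'a) list) \<Rightarrow> bool" where
  "bounded_flow G A \<Phi> \<longleftrightarrow> (\<exists>k::nat. \<forall>e\<in>arcs (cayley_graph G A). length (\<Phi> e) \<le> k)"

definition admits_bounded_flow :: "('a, 'm) monoid_scheme \<Rightarrow> 'a set \<Rightarrow> bool" where
  "admits_bounded_flow G A \<longleftrightarrow>
     (\<exists>T \<Phi>. maximal_tree G A T \<and> flow_function G A T \<Phi> \<and> bounded_flow G A \<Phi>)"

end

theory Submission
  imports Defs
begin

text \<open>
  The two notions are the same data seen from two sides, the dictionary being "degenerate edge = edge
  of the tree". Under it the path that a stacking attaches to a recursive edge is the value of the
  flow function there, both orderings say that recursive edges on that path are smaller, and the
  length bounds agree. The content is that normal forms and maximal trees determine one another.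

  From a stacking to a tree. The degenerate edges carry no circuit: at a vertex of the circuit whose
  normal form is longest, both neighbouring vertices have the normal form with the last letter
  removed, so the circuit enters and leaves along the same undirected edge
  (\<open>degenerate_graph_circuit_free\<close>). They connect all vertices: by well-founded induction along the
  ordering, every edge can be replaced by a path of degenerate edges
  (\<open>degenerate_graph_connected\<close>). So they form a spanning tree.

  From a tree to normal forms. In a graph without circuits two vertices are joined by at most one
  walk without backtracking (\<open>reduced_walk_unique\<close>), so reading the labels of the reduced tree walks
  that start at the identity gives each group element exactly one word. The last step of such a
  walk is a tree edge, and extending a reduced walk by a tree edge either stays reduced or cancels
  the last step; hence the degenerate edges are exactly the tree edges
  (\<open>degenerate_edges_tree_words\<close>).

  Both directions use that the maximal trees of a connected graph are its spanning trees
  (\<open>maximal_tree_iff_spanning\<close>).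
\<close>

section \<open>Reduced walks in graphs with an edge involution\<close>

text \<open>
  A graph in the sense of Serre: the pairs \<open>{e, \<iota> e}\<close> are the undirected edges. The laws are asked
  for on arcs only, so that one and the same involution serves a graph and all its subgraphs.
\<close>

locale serre_graph = wf_digraph H for H :: "('v, 'e) pre_digraph" +
  fixes \<iota> :: "'e \<Rightarrow> 'e"
  assumes inv_arc: "e \<in> arcs H \<Longrightarrow> \<iota> e \<in> arcs H"
    and inv_inv: "e \<in> arcs H \<Longrightarrow> \<iota> (\<iota> e) = e"
    and inv_neq: "e \<in> arcs H \<Longrightarrow> \<iota> e \<noteq> e"
    and tail_inv: "e \<in> arcs H \<Longrightarrow> tail H (\<iota> e) = head H e"

abbreviation reduced :: "('e \<Rightarrow> 'e) \<Rightarrow> 'e list \<Rightarrow> bool" where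
  "reduced \<iota> \<equiv> successively (\<lambda>e f. f \<noteq> \<iota> e)"

text \<open>
  The undirected notions of circuit and tree, stated for an arbitrary edge involution so that the
  facts about them do not depend on the group.
\<close>

definition circuit_free :: "('e \<Rightarrow> 'e) \<Rightarrow> ('v, 'e) pre_digraph \<Rightarrow> bool" where
  "circuit_free \<iota> H \<longleftrightarrow> (\<nexists>p. pre_digraph.cycle H p \<and> (\<forall>e\<in>set p. \<iota> e \<notin> set p))"

definition serre_tree :: "('e \<Rightarrow> 'e) \<Rightarrow> ('v, 'e) pre_digraph \<Rightarrow> bool" where
  "serre_tree \<iota> H \<longleftrightarrow> \<iota> ` arcs H \<subseteq> arcs H \<and> connected H \<and> circuit_free \<iota> H"

lemma (in wf_digraph) closed_walk_next_arc:
  assumes "awalk u p u" "e \<in> set p"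
  shows "\<exists>f\<in>set p. tail G f = head G e"
proof -
  obtain x y where p: "p = x @ e # y" using assms(2) by (meson split_list)
  show ?thesis
  proof (cases y)
    case Nil
    then have "head G e = u" using assms(1) p by (auto simp: awalk_simps)
    moreover have "tail G (hd p) = u" using assms(1) p by (cases x) (auto simp: awalk_simps)
    moreover have "hd p \<in> set p" using p by (intro hd_in_set) simp
    ultimately show ?thesis by auto
  next
    case (Cons f z)
    then have "tail G f = head G e" using assms(1) p by (auto simp: awalk_simps)
    then show ?thesis using p Cons by auto
  qed
qed

lemma (in wf_digraph) closed_walk_previous_arc:
  assumes "awalk u p u" "e \<in> set p"
  shows "\<exists>f\<in>set p. head G f = tail G e"
proof -
  obtain x y where p: "p = x @ e # y" using assms(2) by (meson split_list)
  show ?thesis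
  proof (cases x rule: rev_cases)
    case Nil
    then have "tail G e = u" using assms(1) p by (auto simp: awalk_simps)
    moreover have "head G (last p) = u"
      using awlast_of_awalk[OF assms(1)] p by (simp add: awalk_verts_conv)
    ultimately show ?thesis using p by (intro bexI[of _ "last p"]) auto
  next
    case (snoc z f)
    then have "head G f = tail G e"
      using assms(1) p by (auto simp: awalk_simps)
    then show ?thesis using p snoc by auto
  qed
qed

lemma (in wf_digraph) walk_leaves_set:
  assumes "awalk u p v" "u \<in> S" "v \<notin> S"
  shows "\<exists>e\<in>set p. tail G e \<in> S \<and> head G e \<notin> S"
  using assms by (induction p arbitrary: u) (auto simp: awalk_simps)

text \<open>
  How connectedness passes from a graph to a subgraph that only contains detours for its arcs.
\<close>

lemma (in wf_digraph) reachable_by_replacing_arcs: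
  assumes "awalk u p v" "wf_digraph K" "u \<in> verts K"
    and "\<And>e. e \<in> set p \<Longrightarrow> tail G e \<rightarrow>\<^sup>*\<^bsub>K\<^esub> head G e"
  shows "u \<rightarrow>\<^sup>*\<^bsub>K\<^esub> v"
  using assms(1,3,4)
proof (induction p arbitrary: u)
  case Nil
  then show ?case using wf_digraph.reachable_refl[OF assms(2)] by (auto simp: awalk_Nil_iff)
next
  case (Cons e p)
  then have "u \<rightarrow>\<^sup>*\<^bsub>K\<^esub> head G e" "awalk (head G e) p v" by (auto simp: awalk_Cons_iff)
  moreover from this have "head G e \<rightarrow>\<^sup>*\<^bsub>K\<^esub> v"
    using Cons wf_digraph.reachable_in_verts(2)[OF assms(2)] by auto
  ultimately show ?case using wf_digraph.reachable_trans[OF assms(2)] by blast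
qed

context serre_graph begin

lemma head_inv: "e \<in> arcs H \<Longrightarrow> head H (\<iota> e) = tail H e"
  using tail_inv[of "\<iota> e"] inv_arc inv_inv by simp

lemma symmetric: "symmetric H"
  unfolding symmetric_conv using inv_arc tail_inv head_inv by metis

lemma connected_iff:
  "connected H \<longleftrightarrow> verts H \<noteq> {} \<and> (\<forall>u\<in>verts H. \<forall>v\<in>verts H. \<exists>p. awalk u p v)"
  unfolding connected_def strongly_connected_def
  by (simp add: reachable_mk_symmetric_eq[OF symmetric] reachable_awalk)

lemma serre_subgraph:
  assumes "subgraph K H" "\<iota> ` arcs K \<subseteq> arcs K"
  shows "serre_graph K \<iota>"
proof -
  interpret K: wf_digraph K using assms(1) by blast
  have "tail K = tail H" "head K = head H" "arcs K \<subseteq> arcs H"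
    using assms(1) by (auto simp: subgraph_def compatible_def)
  then show ?thesis
    using assms(2) inv_inv inv_neq tail_inv by unfold_locales (auto simp: subset_iff)
qed

lemma awalk_reverse:
  "awalk u p v \<Longrightarrow> awalk v (rev (map \<iota> p)) u"
proof (induction p arbitrary: u)
  case (Cons e p)
  then have "awalk v (rev (map \<iota> p)) (head H e)" "e \<in> arcs H" "u = tail H e"
    by (auto simp: awalk_Cons_iff)
  moreover have "awalk (head H e) [\<iota> e] u"
    using calculation by (auto simp: awalk_simps inv_arc tail_inv head_inv)
  ultimately show ?case by (auto intro: awalk_appendI)
qed (auto simp: awalk_Nil_iff)

lemma reduced_reverse:
  assumes "reduced \<iota> p" "set p \<subseteq> arcs H"
  shows "reduced \<iota> (rev (map \<iota> p))"
  using assms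
proof (induction p rule: induct_list012)
  case (3 e f p)
  then have "e \<in> arcs H" "f \<in> arcs H" "f \<noteq> \<iota> e" by auto
  then have "\<iota> e \<noteq> \<iota> (\<iota> f)" using inv_inv by metis
  with 3 show ?case by (auto simp: successively_append_iff)
qed auto

text \<open>
  Prepending an arc to a reduced walk either keeps it reduced or cancels its first arc.
\<close>

lemma reduced_walk_exists:
  "awalk u p v \<Longrightarrow> \<exists>q. awalk u q v \<and> reduced \<iota> q"
proof (induction p arbitrary: u)
  case Nil
  then show ?case by (intro exI[of _ "[]"]) auto
next
  case (Cons e p)
  then have e: "e \<in> arcs H" "u = tail H e" "awalk (head H e) p v"
    by (auto simp: awalk_Cons_iff)
  from Cons.IH[OF e(3)] obtain q where q: "awalk (head H e) q v" "reduced \<iota> q" by blast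
  show ?case
  proof (cases "q \<noteq> [] \<and> hd q = \<iota> e")
    case True
    then obtain q' where q': "q = \<iota> e # q'" by (cases q) auto
    then have "awalk u q' v" using q(1) e by (auto simp: awalk_Cons_iff head_inv)
    moreover have "reduced \<iota> q'" using q(2) q' by (auto simp: successively_Cons)
    ultimately show ?thesis by blast
  next
    case False
    then have "reduced \<iota> (e # q)" using q(2) by (auto simp: successively_Cons)
    moreover have "awalk u (e # q) v" using q(1) e by (auto simp: awalk_Cons_iff)
    ultimately show ?thesis by blast
  qed
qed

text \<open>
  The heads of the arcs of a cycle are pairwise distinct, and the arc before \<open>\<iota> e\<close> has the same head
  as \<open>e\<close>, so it is \<open>e\<close> itself and the walk backtracks there. The only escape is that no arc precedes
  \<open>\<iota> e\<close>.
\<close>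

lemma reversed_arc_starts_cycle:
  assumes p: "awalk u p u" "distinct (tl (awalk_verts u p))" "reduced \<iota> p"
    and e: "e \<in> set p" "\<iota> e \<in> set p"
  shows "hd p = \<iota> e"
proof -
  have arcs: "set p \<subseteq> arcs H" using p(1) by blast
  have "distinct (map (head H) p)"
    using p awalk_verts_conv'[of u p u] e(1) by (auto split: if_splits)
  then have inj: "inj_on (head H) (set p)" by (simp add: distinct_map)
  obtain x y where xy: "p = x @ \<iota> e # y" using e(2) by (meson split_list)
  show ?thesis
  proof (cases x rule: rev_cases)
    case (snoc z f)
    then have "head H f = tail H (\<iota> e)" using p(1) xy by (auto simp: awalk_simps)
    then have "head H f = head H e" using tail_inv e arcs by auto
    then have "f = e" using inj e xy snoc by (auto dest: inj_onD)
    then show ?thesis using p(3) xy snoc by (auto simp: successively_append_iff successively_Cons)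
  qed (use xy in simp)
qed

text \<open>
  A nonempty closed reduced walk contains a cycle as a contiguous piece, which is again reduced. As
  it is not a circuit, it traverses some \<open>e\<close> and \<open>\<iota> e\<close>; by the preceding lemma each of the two must
  be its first arc.
\<close>

lemma closed_reduced_walk_trivial:
  assumes "circuit_free \<iota> H" "awalk u p u" "reduced \<iota> p"
  shows "p = []"
  using assms(2,3)
proof (induction "length p" arbitrary: p u rule: less_induct)
  case less
  show ?case
  proof (rule ccontr)
    assume ne: "p \<noteq> []"
    have arcs: "set p \<subseteq> arcs H" using less.prems by blast
    show False
    proof (cases "distinct (tl (awalk_verts u p))")
      case True
      then have "cycle p" using less.prems ne by (auto simp: cycle_def)
      then obtain e where e: "e \<in> set p" "\<iota> e \<in> set p"
        using assms(1) by (auto simp: circuit_free_def)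
      have ii: "\<iota> (\<iota> e) = e" "\<iota> e \<noteq> e" using e arcs inv_inv inv_neq by auto
      have "hd p = \<iota> e" "hd p = \<iota> (\<iota> e)"
        using reversed_arc_starts_cycle[OF less.prems(1) True less.prems(2)] e ii by metis+
      then show False using ii by simp
    next
      case False
      obtain e es where p: "p = e # es" using ne by (cases p) auto
      with less.prems False have "awalk (head H e) es u" "\<not> distinct (awalk_verts (head H e) es)"
        by (auto simp: awalk_Cons_iff)
      from awalk_not_distinct_decomp[OF this] obtain q r s w
        where d: "es = q @ r @ s" "0 < length r" "awalk w r w" by blast
      have "reduced \<iota> r" using less.prems(2) p d(1)
        by (auto simp: successively_append_iff successively_Cons)
      then have "r = []" using less.hyps[of r w] d p by auto
      then show False using d by simp
    qed
  qed
qed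

text \<open>
  Where two reduced walks with common ends first diverge, running back along one and forth along
  the other is a closed walk that is still reduced.
\<close>

lemma reduced_walk_unique:
  assumes "circuit_free \<iota> H"
    and "awalk u p v" "reduced \<iota> p" "awalk u q v" "reduced \<iota> q"
  shows "p = q"
  using assms(2-)
proof (induction p arbitrary: u q)
  case Nil
  then show ?case using closed_reduced_walk_trivial[OF assms(1)] by (auto simp: awalk_Nil_iff)
next
  case (Cons e p)
  show ?case
  proof (cases q)
    case Nil
    then show ?thesis
      using closed_reduced_walk_trivial[OF assms(1), of u "e # p"] Cons.prems
      by (auto simp: awalk_Nil_iff)
  next
    case q: (Cons f q')
    show ?thesis
    proof (cases "f = e")
      case True
      then show ?thesis
        using Cons.IH[of "head H e" q'] Cons.prems q
        by (auto simp: awalk_Cons_iff successively_Cons)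
    next
      case False
      let ?c = "rev (map \<iota> (e # p)) @ q"
      have e: "e \<in> arcs H" using Cons.prems by (auto simp: awalk_Cons_iff)
      have "awalk v ?c v" using awalk_appendI[OF awalk_reverse] Cons.prems by blast
      moreover have "reduced \<iota> ?c"
      proof -
        have "reduced \<iota> (rev (map \<iota> (e # p)))"
          using reduced_reverse Cons.prems(1,2) by blast
        moreover have "last (rev (map \<iota> (e # p))) = \<iota> e" by simp
        ultimately show ?thesis
          using Cons.prems(4) q False inv_inv[OF e]
          by (simp only: successively_append_iff) simp
      qed
      ultimately show ?thesis using closed_reduced_walk_trivial[OF assms(1)] by blast
    qed
  qed
qed


subsection \<open>Maximal trees are spanning trees\<close>

text \<open>
  A new vertex attached by one undirected edge lies on no circuit: that edge is the only way in and
  the only way out.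
\<close>

lemma attach_leaf:
  assumes sub: "subgraph K H" and tree: "serre_tree \<iota> K"
    and e: "e \<in> arcs H" "tail H e \<in> verts K" "head H e \<notin> verts K"
  defines "L \<equiv> H\<lparr>verts := insert (head H e) (verts K), arcs := {e, \<iota> e} \<union> arcs K\<rparr>"
  shows "subgraph L H" "subgraph K L" "serre_tree \<iota> L"
proof -
  have KH: "tail K = tail H" "head K = head H" "arcs K \<subseteq> arcs H" "verts K \<subseteq> verts H"
    using sub by (auto simp: subgraph_def compatible_def)
  interpret K: serre_graph K \<iota>
    using serre_subgraph[OF sub] tree by (simp add: serre_tree_def)
  have L: "verts L = insert (head H e) (verts K)" "arcs L = {e, \<iota> e} \<union> arcs K"
    "tail L = tail H" "head L = head H" by (auto simp: L_def)
  interpret L: wf_digraph L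
    using e K.wellformed KH by unfold_locales (auto simp: L tail_inv head_inv)
  show sL: "subgraph L H"
    using KH e inv_arc L.wf_digraph_axioms wf_digraph_axioms
    by (auto simp: subgraph_def compatible_def L)
  show KL: "subgraph K L"
    using KH K.wf_digraph_axioms L.wf_digraph_axioms
    by (auto simp: subgraph_def compatible_def L)
  have closed: "\<iota> ` arcs L \<subseteq> arcs L" using K.inv_arc e by (auto simp: L inv_inv)
  interpret L: serre_graph L \<iota> using serre_subgraph[OF sL closed] .
  have reach_tail: "tail H e \<rightarrow>\<^sup>*\<^bsub>L\<^esub> v \<and> v \<rightarrow>\<^sup>*\<^bsub>L\<^esub> tail H e" if v: "v \<in> verts L" for v
  proof (cases "v = head H e")
    case True
    have "e \<in> arcs L" "\<iota> e \<in> arcs L" by (auto simp: L)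
    then show ?thesis
      using L.in_arcs_imp_in_arcs_ends[of e] L.in_arcs_imp_in_arcs_ends[of "\<iota> e"] True e(1)
      by (auto simp: L tail_inv head_inv)
  next
    case False
    then have vK: "v \<in> verts K" using v by (auto simp: L)
    have cK: "connected K" using tree by (simp add: serre_tree_def)
    have "tail H e \<rightarrow>\<^sup>*\<^bsub>K\<^esub> v" "v \<rightarrow>\<^sup>*\<^bsub>K\<^esub> tail H e"
      using K.connected_iff cK vK e(2) by (auto simp: K.reachable_awalk)
    then show ?thesis using pre_digraph.reachable_mono[OF _ KL] by blast
  qed
  have "connected L"
    unfolding L.connected_iff L.reachable_awalk[symmetric]
    using reach_tail L.reachable_trans by (auto simp: L) blast+
  moreover have "circuit_free \<iota> L"
    unfolding circuit_free_def
  proof (rule notI, elim exE conjE)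
    fix p assume "L.cycle p" and no_inv: "\<forall>f\<in>set p. \<iota> f \<notin> set p"
    then obtain u where u: "L.awalk u p u" "distinct (tl (L.awalk_verts u p))" "p \<noteq> []"
      by (auto simp: L.cycle_def)
    have pL: "set p \<subseteq> arcs L" using u by blast
    have arcK: "tail H f \<in> verts K" "head H f \<in> verts K" if "f \<in> arcs K" for f
      using K.wellformed[OF that] KH by auto
    have "e \<notin> set p"
    proof
      assume "e \<in> set p"
      then obtain f where f: "f \<in> set p" "tail H f = head H e"
        using L.closed_walk_next_arc[OF u(1), of e] unfolding L by blast
      then have "f \<noteq> e" "f \<notin> arcs K" using e arcK by metis+
      then have "f = \<iota> e" using pL f by (auto simp: L)
      then show False using no_inv \<open>e \<in> set p\<close> f by blast
    qed
    moreover have "\<iota> e \<notin> set p"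
    proof
      assume a: "\<iota> e \<in> set p"
      then obtain f where f: "f \<in> set p" "head H f = head H e"
        using L.closed_walk_previous_arc[OF u(1) a] unfolding L tail_inv[OF e(1)] by blast
      then have "f \<noteq> \<iota> e" "f \<notin> arcs K" using e arcK head_inv by metis+
      then have "f = e" using pL f by (auto simp: L)
      then show False using no_inv a f by blast
    qed
    ultimately have pK: "set p \<subseteq> arcs K" using pL by (auto simp: L)
    have comp: "compatible K L" by (auto simp: compatible_def KH L)
    have "K.awalk u p u"
      using u pK arcK compatible_cas[OF comp]
      by (cases p) (auto simp: K.awalk_def L.awalk_def L)
    then have "K.cycle p"
      using u compatible_awalk_verts[OF comp] by (auto simp: K.cycle_def)
    then show False using tree no_inv by (auto simp: serre_tree_def circuit_free_def)
  qed
  ultimately show "serre_tree \<iota> L" using closed by (simp add: serre_tree_def)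
qed

text \<open>
  A tree missing a vertex can be enlarged by a leaf, since some arc leads out of it. Conversely an arc
  \<open>e\<close> outside a spanning tree, followed by the reduced tree walk back from its head to its tail, is a
  closed reduced walk, so no tree contains both \<open>e\<close> and the spanning tree.
\<close>

theorem maximal_tree_iff_spanning:
  assumes conn: "connected H"
  shows "max_subgraph (serre_tree \<iota>) K \<longleftrightarrow> serre_tree \<iota> K \<and> spanning K H"
proof
  assume max: "max_subgraph (serre_tree \<iota>) K"
  then have K: "subgraph K H" "serre_tree \<iota> K" by (auto simp: max_subgraph_def)
  have "verts K = verts H"
  proof (rule ccontr)
    assume "verts K \<noteq> verts H"
    then obtain v where v: "v \<in> verts H" "v \<notin> verts K" using K(1) by blast
    have "verts K \<noteq> {}"
      using K(2) by (auto simp: serre_tree_def connected_def strongly_connected_def)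
    then obtain u where u: "u \<in> verts K" by blast
    then obtain p where p: "awalk u p v" using conn v K(1) unfolding connected_iff by blast
    from walk_leaves_set[OF p u v(2)] obtain e
      where e: "e \<in> arcs H" "tail H e \<in> verts K" "head H e \<notin> verts K" using p by blast
    let ?L = "H\<lparr>verts := insert (head H e) (verts K), arcs := {e, \<iota> e} \<union> arcs K\<rparr>"
    have "?L \<noteq> K" using e(3)
      by (metis (no_types) insertI1 pre_digraph.select_convs(1) pre_digraph.surjective
          pre_digraph.update_convs(1,2))
    then show False using max attach_leaf[OF K e] unfolding max_subgraph_def by blast
  qed
  then show "serre_tree \<iota> K \<and> spanning K H" using K by (simp add: spanning_def)
next
  assume K: "serre_tree \<iota> K \<and> spanning K H"
  then have sub: "subgraph K H" and vK: "verts K = verts H" by (auto simp: spanning_def)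
  interpret K: serre_graph K \<iota> using serre_subgraph[OF sub] K by (simp add: serre_tree_def)
  show "max_subgraph (serre_tree \<iota>) K"
    unfolding max_subgraph_def
  proof (intro conjI allI impI notI)
    fix L assume L: "L \<noteq> K \<and> subgraph K L" "subgraph L H \<and> serre_tree \<iota> L"
    interpret L: serre_graph L \<iota> using serre_subgraph[of L] L by (simp add: serre_tree_def)
    have KL: "tail K = tail L" "head K = head L" "arcs K \<subseteq> arcs L" "verts K = verts L"
      using L vK by (auto simp: subgraph_def compatible_def)
    then have "arcs K \<noteq> arcs L" using L(1) by (metis pre_digraph.equality unit.exhaust)
    then obtain e where e: "e \<in> arcs L" "e \<notin> arcs K" using KL by blast
    then have "tail L e \<in> verts K" "head L e \<in> verts K" using KL by auto
    moreover have "connected K" using K by (simp add: serre_tree_def)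
    ultimately obtain q where "K.awalk (head L e) q (tail L e)"
      unfolding K.connected_iff by blast
    then obtain p where p: "K.awalk (head L e) p (tail L e)" "reduced \<iota> p"
      using K.reduced_walk_exists by blast
    have "L.awalk (tail L e) (e # p) (tail L e)"
      using L.subgraph_awalk_imp_awalk[OF p(1)] L e by (simp add: L.awalk_Cons_iff)
    moreover have "reduced \<iota> (e # p)"
    proof -
      have "\<iota> e \<notin> arcs K" using K.inv_arc[of "\<iota> e"] e L.inv_inv by auto
      then have "\<iota> e \<notin> set p" using p(1) by blast
      then show ?thesis using p(2) by (cases p) auto
    qed
    ultimately show False
      using L.closed_reduced_walk_trivial L(2) by (auto simp: serre_tree_def)
  qed (use K sub in auto)
qed

end

section \<open>Cayley graphs\<close>

locale cayley = group G for G (structure) +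
  fixes A :: "'a set"
  assumes generating: "symmetric_generating_set G A"
    and one_notin: "\<one> \<notin> A"
begin

abbreviation "\<Gamma> \<equiv> cayley_graph G A"

lemma A_carrier: "a \<in> A \<Longrightarrow> a \<in> carrier G" and inv_A: "a \<in> A \<Longrightarrow> inv a \<in> A"
  using generating by (auto simp: symmetric_generating_set_def)

lemma cayley_simps [simp]:
  "verts \<Gamma> = carrier G" "arcs \<Gamma> = carrier G \<times> A" "tail \<Gamma> = fst" "head \<Gamma> (g, a) = g \<otimes> a"
  by (simp_all add: cayley_graph_def)

lemma edge_inv_inv: "e \<in> arcs \<Gamma> \<Longrightarrow> edge_inv G (edge_inv G e) = e"
  by (auto simp: edge_inv_def m_assoc A_carrier)

lemma cayley_serre_graph: "serre_graph \<Gamma> (edge_inv G)"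
proof
  fix e assume e: "e \<in> arcs \<Gamma>"
  then obtain g a where ga: "e = (g, a)" "g \<in> carrier G" "a \<in> A" by auto
  show "tail \<Gamma> e \<in> verts \<Gamma>" "head \<Gamma> e \<in> verts \<Gamma>" "edge_inv G e \<in> arcs \<Gamma>"
    "tail \<Gamma> (edge_inv G e) = head \<Gamma> e"
    using ga by (auto simp: edge_inv_def A_carrier inv_A)
  show "edge_inv G (edge_inv G e) = e" using edge_inv_inv e .
  have "g \<otimes> a \<noteq> g" using ga one_notin A_carrier r_cancel_one by auto
  then show "edge_inv G e \<noteq> e" using ga by (simp add: edge_inv_def)
qed

end

sublocale cayley \<subseteq> serre_graph "cayley_graph G A" "edge_inv G"
  by (rule cayley_serre_graph)

context cayley
begin

lemma arc_reachable:
  assumes "g \<in> carrier G" "a \<in> A"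
  shows "g \<rightarrow>\<^sup>*\<^bsub>\<Gamma>\<^esub> (g \<otimes> a)"
  using assms in_arcs_imp_in_arcs_ends[of "(g, a)"] by (intro reachable_adjI) simp

lemma cayley_connected: "connected \<Gamma>"
proof -
  have step: "u \<rightarrow>\<^sup>*\<^bsub>\<Gamma>\<^esub> (u \<otimes> h)" if "h \<in> generate G A" "u \<in> carrier G" for u h
    using that
  proof (induction h arbitrary: u rule: generate.induct)
    case (eng h1 h2)
    have c: "h1 \<in> carrier G" "h2 \<in> carrier G"
      using eng.hyps generate_in_carrier[of A] A_carrier by blast+
    then have "u \<rightarrow>\<^sup>*\<^bsub>\<Gamma>\<^esub> (u \<otimes> h1)" "(u \<otimes> h1) \<rightarrow>\<^sup>*\<^bsub>\<Gamma>\<^esub> (u \<otimes> h1 \<otimes> h2)"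
      using eng by auto
    then show ?case using reachable_trans c eng.prems by (simp add: m_assoc)
  qed (auto intro: arc_reachable inv_A)
  have "u \<rightarrow>\<^sup>*\<^bsub>\<Gamma>\<^esub> v" if "u \<in> carrier G" "v \<in> carrier G" for u v
  proof -
    have "inv u \<otimes> v \<in> generate G A"
      using generating that by (simp add: symmetric_generating_set_def)
    then have "u \<rightarrow>\<^sup>*\<^bsub>\<Gamma>\<^esub> (u \<otimes> (inv u \<otimes> v))" using step that by blast
    then show ?thesis using that by (simp add: m_assoc[symmetric])
  qed
  then show ?thesis unfolding connected_iff reachable_awalk[symmetric] by auto
qed

lemma undirected_tree_eq: "undirected_tree G = serre_tree (edge_inv G)"
  by (simp add: fun_eq_iff undirected_tree_def serre_tree_def circuit_free_def circuit_def)

lemma maximal_tree_iff: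
  "maximal_tree G A T \<longleftrightarrow> serre_tree (edge_inv G) T \<and> spanning T \<Gamma>"
  unfolding maximal_tree_def undirected_tree_eq
  by (rule maximal_tree_iff_spanning[OF cayley_connected])

lemma word_eval_carrier: "w \<in> lists A \<Longrightarrow> word_eval G w \<in> carrier G"
  by (induction w) (auto simp: word_eval_def A_carrier)

lemma path_end:
  "awalk g p h \<Longrightarrow> map snd p \<in> lists A \<and> h = g \<otimes> word_eval G (map snd p)"
proof (induction p arbitrary: g)
  case Nil
  then show ?case by (auto simp: awalk_Nil_iff word_eval_def)
next
  case (Cons e p)
  then obtain a where e: "e = (g, a)" "a \<in> A" "g \<in> carrier G" "awalk (g \<otimes> a) p h"
    by (cases e) (auto simp: awalk_Cons_iff)
  then show ?case
    using Cons.IH[OF e(4)] word_eval_carrier[of "map snd p"]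
    by (auto simp: word_eval_def m_assoc A_carrier)
qed

lemma path_determined_by_label:
  "awalk g p h \<Longrightarrow> awalk g q h' \<Longrightarrow> map snd p = map snd q \<Longrightarrow> p = q"
proof (induction p arbitrary: g q)
  case (Cons e p)
  then obtain f q' where "q = f # q'" by (cases q) auto
  with Cons show ?case by (auto simp: awalk_Cons_iff prod_eq_iff)
qed simp

lemma degenerate_edge_iff:
  "(g, a) \<in> degenerate_edges G A N \<longleftrightarrow> g \<in> carrier G \<and> a \<in> A \<and>
     (nf G N g @ [a] = nf G N (g \<otimes> a) \<or> nf G N g = nf G N (g \<otimes> a) @ [inv a])"
  by (auto simp: degenerate_edges_def)


subsection \<open>From stackings to flow functions\<close>

definition degenerate_graph :: "'a list set \<Rightarrow> ('a, 'a \<times> 'a) pre_digraph" where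
  "degenerate_graph N = \<Gamma>\<lparr>arcs := degenerate_edges G A N\<rparr>"

lemma degenerate_graph_simps [simp]:
  "verts (degenerate_graph N) = carrier G"
  "arcs (degenerate_graph N) = degenerate_edges G A N"
  "tail (degenerate_graph N) = fst"
  "head (degenerate_graph N) = head \<Gamma>"
  by (simp_all add: degenerate_graph_def)

lemma degenerate_graph_subgraph: "subgraph (degenerate_graph N) \<Gamma>"
proof -
  have "wf_digraph (degenerate_graph N)"
    by unfold_locales (auto simp: degenerate_edge_iff A_carrier)
  then show ?thesis
    using wf_digraph_axioms
    by (auto simp: subgraph_def compatible_def degenerate_edge_iff)
qed

lemma degenerate_edges_inv:
  "edge_inv G ` degenerate_edges G A N \<subseteq> degenerate_edges G A N"
  by (auto simp: edge_inv_def degenerate_edge_iff A_carrier inv_A m_assoc)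

text \<open>
  Crossing a degenerate edge changes the normal form by one letter at its end. Where the normal form
  is longest along a circuit, the incoming edge appends a letter and the outgoing one removes that
  same letter.
\<close>

lemma degenerate_graph_circuit_free: "circuit_free (edge_inv G) (degenerate_graph N)"
  unfolding circuit_free_def
proof (rule notI, elim exE conjE)
  interpret D: wf_digraph "degenerate_graph N" using degenerate_graph_subgraph by blast
  fix p assume "D.cycle p" and no_inv: "\<forall>e\<in>set p. edge_inv G e \<notin> set p"
  then obtain x where p: "D.awalk x p x" "p \<noteq> []" by (auto simp: D.cycle_def)
  then have arcs: "set p \<subseteq> degenerate_edges G A N" by (auto simp: D.awalk_def)
  define len where "len e = length (nf G N (head \<Gamma> e))" for e
  \<comment> \<open>An arc maximizing \<open>len\<close> enters a vertex of the circuit with longest normal form.\<close>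
  have "Max (len ` set p) \<in> len ` set p" using p(2) by (intro Max_in) auto
  then obtain e where e: "e \<in> set p" "len e = Max (len ` set p)" by auto
  have max: "len f \<le> len e" if "f \<in> set p" for f unfolding e(2) using that by simp
  obtain f where f: "f \<in> set p" "fst f = head \<Gamma> e"
    using D.closed_walk_next_arc[OF p(1) e(1)] by auto
  obtain d where d: "d \<in> set p" "head \<Gamma> d = fst e"
    using D.closed_walk_previous_arc[OF p(1) e(1)] by auto
  obtain u b c where ub: "e = (u, b)" "f = (u \<otimes> b, c)" using f(2) by (cases e; cases f) auto
  have deg: "(u, b) \<in> degenerate_edges G A N" "(u \<otimes> b, c) \<in> degenerate_edges G A N"
    using arcs e(1) f(1) ub by auto
  have "length (nf G N u) \<le> length (nf G N (u \<otimes> b))"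
    using max[OF d(1)] d(2) ub by (simp add: len_def)
  then have in_edge: "nf G N u @ [b] = nf G N (u \<otimes> b)"
    using deg(1) by (auto simp: degenerate_edge_iff)
  have "length (nf G N (u \<otimes> b \<otimes> c)) \<le> length (nf G N (u \<otimes> b))"
    using max[OF f(1)] ub by (simp add: len_def)
  then have out_edge: "nf G N (u \<otimes> b) = nf G N (u \<otimes> b \<otimes> c) @ [inv c]"
    using deg(2) by (auto simp: degenerate_edge_iff dest: arg_cong[where f = length])
  have "b = inv c" using in_edge out_edge by (metis append1_eq_conv)
  then have "edge_inv G e = f"
    using deg(2) ub by (simp add: edge_inv_def degenerate_edge_iff A_carrier)
  then show False using no_inv e(1) f(1) by auto
qed

text \<open>
  By well-founded induction the ends of every edge are joined by degenerate edges, since the edges of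
  its stacking path are degenerate or smaller. The Cayley graph being connected, this suffices.
\<close>

lemma degenerate_graph_connected:
  assumes "wf r"
    and stack: "\<And>g a. g \<in> carrier G \<Longrightarrow> a \<in> A \<Longrightarrow>
      \<exists>p. awalk g p (g \<otimes> a) \<and> (\<forall>e'\<in>set p. (e', (g, a)) \<in> r \<or> e' \<in> degenerate_edges G A N)"
  shows "connected (degenerate_graph N)"
proof -
  let ?D = "degenerate_graph N"
  interpret D: serre_graph ?D "edge_inv G"
    by (intro serre_subgraph degenerate_graph_subgraph) (simp add: degenerate_edges_inv)
  have arc: "tail \<Gamma> e \<rightarrow>\<^sup>*\<^bsub>?D\<^esub> head \<Gamma> e" if "e \<in> degenerate_edges G A N" for e
    using that D.in_arcs_imp_in_arcs_ends[of e] by auto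
  have edge: "tail \<Gamma> e \<rightarrow>\<^sup>*\<^bsub>?D\<^esub> head \<Gamma> e" if "e \<in> arcs \<Gamma>" for e
    using assms(1) that
  proof (induction e rule: wf_induct_rule)
    case (less e)
    obtain g a where e: "e = (g, a)" "g \<in> carrier G" "a \<in> A" using less.prems by auto
    then obtain p where p: "awalk g p (g \<otimes> a)"
      "\<forall>e'\<in>set p. (e', e) \<in> r \<or> e' \<in> degenerate_edges G A N"
      using stack by blast
    have "tail \<Gamma> e' \<rightarrow>\<^sup>*\<^bsub>?D\<^esub> head \<Gamma> e'" if "e' \<in> set p" for e'
    proof -
      have "e' \<in> arcs \<Gamma>" using that p(1) by (auto simp only: awalk_def)
      then show ?thesis using that p(2) less.IH[of e'] arc by blast
    qed
    then show ?case
      using reachable_by_replacing_arcs[OF p(1) D.wf_digraph_axioms] e by simp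
  qed
  show ?thesis
    unfolding D.connected_iff D.reachable_awalk[symmetric]
  proof (intro conjI ballI)
    fix u v assume "u \<in> verts ?D" "v \<in> verts ?D"
    then obtain p where p: "awalk u p v" using cayley_connected by (auto simp: connected_iff)
    then show "u \<rightarrow>\<^sup>*\<^bsub>?D\<^esub> v"
      using reachable_by_replacing_arcs[OF p D.wf_digraph_axioms] edge \<open>u \<in> verts ?D\<close> by blast
  qed auto
qed

text \<open>
  The flow follows the stacking paths off the tree. Its relation is then contained in the given
  ordering, and transitivity keeps the transitive closure inside it as well.
\<close>

theorem stackable_imp_bounded_flow:
  assumes "stackable G A"
  shows "admits_bounded_flow G A"
proof -
  obtain N r k where r: "wf_strict_order_on (recursive_edges G A N) r"
    and stack: "\<And>g a. g \<in> carrier G \<Longrightarrow> a \<in> A \<Longrightarrow>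
      \<exists>p. awalk g p (g \<otimes> a) \<and> length p \<le> k \<and>
        (\<forall>e'\<in>set p. (e', (g, a)) \<in> r \<or> e' \<in> degenerate_edges G A N)"
    using assms unfolding stackable_def by meson
  let ?D = "degenerate_edges G A N" and ?T = "degenerate_graph N"
  have wf: "wf r" "trans r" using r by (auto simp: wf_strict_order_on_def)
  have "connected ?T"
    using degenerate_graph_connected[OF wf(1)] stack by blast
  then have T: "maximal_tree G A ?T"
    using degenerate_graph_circuit_free degenerate_edges_inv degenerate_graph_subgraph
    by (simp add: maximal_tree_iff serre_tree_def spanning_def)
  have "\<forall>e\<in>arcs \<Gamma>. \<exists>p. awalk (tail \<Gamma> e) p (head \<Gamma> e) \<and> length p \<le> k \<and>
      (\<forall>e'\<in>set p. (e', e) \<in> r \<or> e' \<in> ?D)"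
    using stack by auto
  then obtain F where F: "\<And>e. e \<in> arcs \<Gamma> \<Longrightarrow>
      awalk (tail \<Gamma> e) (F e) (head \<Gamma> e) \<and> length (F e) \<le> k \<and>
      (\<forall>e'\<in>set (F e). (e', e) \<in> r \<or> e' \<in> ?D)"
    by metis
  define \<Phi> where "\<Phi> e = (if e \<in> ?D then [e] else F e)" for e
  have path: "awalk (tail \<Gamma> e) (\<Phi> e) (head \<Gamma> e)" if "e \<in> arcs \<Gamma>" for e
    using F[OF that] arc_implies_awalk[OF that] by (simp add: \<Phi>_def)
  let ?R = "{(e', e). e \<in> arcs \<Gamma> \<and> e' \<in> set (\<Phi> e) \<and> e \<notin> ?D \<and> e' \<notin> ?D}"
  have "?R \<subseteq> r" using F by (auto simp: \<Phi>_def)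
  then have "?R\<^sup>+ \<subseteq> r" using trancl_mono_subset[of ?R r] trancl_id[OF wf(2)] by simp
  then have wf_flow: "wf (?R\<^sup>+)" using wf(1) wf_subset by blast
  have "set (\<Phi> e) \<subseteq> arcs \<Gamma>" if "e \<in> arcs \<Gamma>" for e using path[OF that] by blast
  then have "?R \<subseteq> arcs \<Gamma> \<times> arcs \<Gamma>" by blast
  then have "?R\<^sup>+ \<subseteq> arcs \<Gamma> \<times> arcs \<Gamma>" by (rule trancl_subset_Sigma)
  then have "wf_strict_order_on (arcs \<Gamma>) (flow_less G A ?T \<Phi>)"
    using wf_flow wf_irrefl[OF wf_flow]
    unfolding wf_strict_order_on_def flow_less_def degenerate_graph_simps
    by (auto simp: irrefl_def)
  then have "flow_function G A ?T \<Phi>"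
    using path unfolding flow_function_def by (simp add: \<Phi>_def)
  \<comment> \<open>The maximum with 1 covers the one-edge values on the tree if the stacking bound is 0.\<close>
  moreover have "bounded_flow G A \<Phi>"
    unfolding bounded_flow_def using F
    by (intro exI[of _ "max 1 k"]) (auto simp: \<Phi>_def le_max_iff_disj)
  ultimately show ?thesis using T unfolding admits_bounded_flow_def by blast
qed


subsection \<open>From flow functions to stackings\<close>

definition tree_words :: "('a, 'a \<times> 'a) pre_digraph \<Rightarrow> 'a list set" where
  "tree_words T = {map snd p | p g. pre_digraph.awalk T \<one> p g \<and> reduced (edge_inv G) p}"

context
  fixes T :: "('a, 'a \<times> 'a) pre_digraph"
  assumes tree: "serre_tree (edge_inv G) T" and span: "spanning T \<Gamma>"
begin

interpretation T: serre_graph T "edge_inv G"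
  using span tree serre_subgraph by (auto simp: spanning_def serre_tree_def)

lemma T_simps: "tail T = fst" "head T = head \<Gamma>" "verts T = carrier G" "arcs T \<subseteq> arcs \<Gamma>"
  using span by (auto simp: spanning_def subgraph_def compatible_def)

lemma T_walk: "T.awalk u p v \<Longrightarrow> awalk u p v"
  using subgraph_awalk_imp_awalk span by (auto simp: spanning_def)

lemma reduced_tree_walk_exists:
  assumes "g \<in> carrier G"
  shows "\<exists>p. T.awalk \<one> p g \<and> reduced (edge_inv G) p"
proof -
  have "connected T" using tree by (simp add: serre_tree_def)
  then obtain p where "T.awalk \<one> p g"
    using assms T_simps(3) one_closed unfolding T.connected_iff by metis
  then show ?thesis using T.reduced_walk_exists by blast
qed

lemma tree_words_normal_forms: "normal_forms G A (tree_words T)"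
proof -
  have "inj_on (word_eval G) (tree_words T)"
  proof (rule inj_onI)
    fix v w assume "v \<in> tree_words T" "w \<in> tree_words T" and eq: "word_eval G v = word_eval G w"
    then obtain p g q h where p: "v = map snd p" "T.awalk \<one> p g" "reduced (edge_inv G) p"
      and q: "w = map snd q" "T.awalk \<one> q h" "reduced (edge_inv G) q"
      by (auto simp: tree_words_def)
    have "g = h" using path_end[OF T_walk[OF p(2)]] path_end[OF T_walk[OF q(2)]] p q eq by simp
    then show "v = w" using T.reduced_walk_unique p q tree by (auto simp: serre_tree_def)
  qed
  moreover have "word_eval G ` tree_words T = carrier G"
  proof (intro equalityI subsetI)
    fix g assume "g \<in> word_eval G ` tree_words T"
    then show "g \<in> carrier G"
      using word_eval_carrier path_end[OF T_walk] unfolding tree_words_def by blast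
  next
    fix g assume "g \<in> carrier G"
    then obtain q where q: "T.awalk \<one> q g" "reduced (edge_inv G) q"
      using reduced_tree_walk_exists by blast
    then have "g = word_eval G (map snd q)"
      using path_end[OF T_walk[OF q(1)]] word_eval_carrier by simp
    then show "g \<in> word_eval G ` tree_words T" using q unfolding tree_words_def by blast
  qed
  moreover have "tree_words T \<subseteq> lists A" using path_end[OF T_walk] by (auto simp: tree_words_def)
  ultimately show ?thesis by (simp add: normal_forms_def bij_betw_def)
qed

lemma nf_tree_words:
  assumes "T.awalk \<one> p g" "reduced (edge_inv G) p"
  shows "nf G (tree_words T) g = map snd p"
proof -
  have "map snd p \<in> tree_words T" using assms by (auto simp: tree_words_def)
  moreover have "word_eval G (map snd p) = g"
    using path_end[OF T_walk[OF assms(1)]] word_eval_carrier by simp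
  ultimately show ?thesis
    using tree_words_normal_forms unfolding nf_def normal_forms_def bij_betw_def
    by (auto intro: the_inv_into_f_eq)
qed

lemma reduced_tree_walk:
  assumes "g \<in> carrier G"
  obtains p where "T.awalk \<one> p g" "reduced (edge_inv G) p" "nf G (tree_words T) g = map snd p"
  using reduced_tree_walk_exists[OF assms] nf_tree_words that by blast

text \<open>
  The reduced tree walk to \<open>g \<otimes> a\<close> and the one to \<open>g\<close> followed by \<open>(g, a)\<close> have the same starting
  point and the same label, hence are the same path of the Cayley graph.
\<close>

lemma nf_snoc_imp_tree_edge:
  assumes "g \<in> carrier G" "a \<in> A" "nf G (tree_words T) (g \<otimes> a) = nf G (tree_words T) g @ [a]"
  shows "(g, a) \<in> arcs T"
proof -
  obtain p where p: "T.awalk \<one> p g" "nf G (tree_words T) g = map snd p"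
    using reduced_tree_walk assms(1) by metis
  obtain q where q: "T.awalk \<one> q (g \<otimes> a)" "nf G (tree_words T) (g \<otimes> a) = map snd q"
    using reduced_tree_walk assms A_carrier by (metis m_closed)
  have "awalk \<one> (p @ [(g, a)]) (g \<otimes> a)"
    using T_walk[OF p(1)] assms A_carrier by (auto simp: awalk_simps intro!: awalk_appendI)
  moreover have "map snd (p @ [(g, a)]) = map snd q" using p(2) q(2) assms(3) by simp
  ultimately have "p @ [(g, a)] = q" using path_determined_by_label T_walk[OF q(1)] by blast
  then show ?thesis using q(1) by (auto simp: T.awalk_def)
qed

text \<open>
  The inclusion of the degenerate edges in the tree is the preceding lemma, applied to an edge or to
  its inverse. For the other one, append the tree edge \<open>e\<close> to the reduced walk to its tail: either the
  result is the reduced walk to its head, or that walk ended with the inverse of \<open>e\<close> and dropping this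
  last step gives the reduced walk to the head.
\<close>

lemma degenerate_edges_tree_words: "degenerate_edges G A (tree_words T) = arcs T"
proof (intro equalityI subsetI)
  fix e assume e: "e \<in> degenerate_edges G A (tree_words T)"
  obtain g a where ga: "e = (g, a)" by (cases e)
  have c: "g \<in> carrier G" "a \<in> A" using e ga by (auto simp: degenerate_edge_iff)
  consider "nf G (tree_words T) (g \<otimes> a) = nf G (tree_words T) g @ [a]"
    | "nf G (tree_words T) g = nf G (tree_words T) (g \<otimes> a) @ [inv a]"
    using e ga by (auto simp: degenerate_edge_iff)
  then show "e \<in> arcs T"
  proof cases
    case 1
    then show ?thesis using nf_snoc_imp_tree_edge c ga by simp
  next
    case 2
    then have "edge_inv G e \<in> arcs T"
      using nf_snoc_imp_tree_edge[of "g \<otimes> a" "inv a"] c ga A_carrier inv_A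
      by (simp add: edge_inv_def m_assoc)
    then show ?thesis using T.inv_arc edge_inv_inv[of e] c ga by fastforce
  qed
next
  fix e assume e: "e \<in> arcs T"
  then obtain g a where ga: "e = (g, a)" "g \<in> carrier G" "a \<in> A" using T_simps by auto
  obtain p where p: "T.awalk \<one> p g" "reduced (edge_inv G) p" "nf G (tree_words T) g = map snd p"
    using reduced_tree_walk ga by blast
  have "T.awalk g [e] (g \<otimes> a)" using e ga T.arc_implies_awalk[OF e] T_simps by simp
  then have pe: "T.awalk \<one> (p @ [e]) (g \<otimes> a)" using T.awalk_appendI p(1) by blast
  show "e \<in> degenerate_edges G A (tree_words T)"
  proof (cases "reduced (edge_inv G) (p @ [e])")
    case True
    then show ?thesis using nf_tree_words[OF pe] p ga by (simp add: degenerate_edge_iff)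
  next
    case False
    then have "p \<noteq> []" "edge_inv G (last p) = e" using p(2) by (auto simp: successively_append_iff)
    moreover from this have "last p \<in> arcs \<Gamma>"
      using p(1) T_simps(4) last_in_set unfolding T.awalk_def by blast
    ultimately have "edge_inv G e = last p" using edge_inv_inv by metis
    then obtain q where q: "p = q @ [edge_inv G e]" using \<open>p \<noteq> []\<close> by (metis append_butlast_last_id)
    have "T.awalk \<one> q (g \<otimes> a)"
      using p(1) q T_simps by (auto simp: T.awalk_simps edge_inv_def ga)
    moreover have "reduced (edge_inv G) q" using p(2) q by (simp add: successively_append_iff)
    ultimately have "nf G (tree_words T) (g \<otimes> a) = map snd q" using nf_tree_words by blast
    then show ?thesis using p(3) q ga by (simp add: degenerate_edge_iff edge_inv_def)
  qed
qed

end

text \<open>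
  With the tree words as normal forms, the flow function and its ordering serve as the stacking
  unchanged: a path attached to a tree edge consists of that edge alone, and any non-tree edge on the
  path of another edge is below it by definition.
\<close>

theorem bounded_flow_imp_stackable:
  assumes "admits_bounded_flow G A"
  shows "stackable G A"
proof -
  obtain T \<Phi> k where T: "serre_tree (edge_inv G) T" "spanning T \<Gamma>"
    and flow: "flow_function G A T \<Phi>" and bound: "\<forall>e\<in>arcs \<Gamma>. length (\<Phi> e) \<le> k"
    using assms by (auto simp: admits_bounded_flow_def maximal_tree_iff bounded_flow_def)
  let ?N = "tree_words T" and ?r = "flow_less G A T \<Phi>"
  have deg: "degenerate_edges G A ?N = arcs T" by (rule degenerate_edges_tree_words[OF T])
  have rec: "recursive_edges G A ?N = arcs \<Gamma> - arcs T" by (simp add: recursive_edges_def deg)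
  have path: "awalk (tail \<Gamma> e) (\<Phi> e) (head \<Gamma> e)" if "e \<in> arcs \<Gamma>" for e
    using flow that unfolding flow_function_def by blast
  have tree_edge: "\<Phi> e = [e]" if "e \<in> arcs T" "e \<in> arcs \<Gamma>" for e
    using flow that unfolding flow_function_def by blast
  have verts: "\<one> \<in> verts T" using T(2) by (auto simp: spanning_def)
  then have "[] \<in> ?N"
    by (auto simp: tree_words_def pre_digraph.awalk_def pre_digraph.cas.simps)
  moreover have "wf_strict_order_on (recursive_edges G A ?N) ?r"
  proof -
    have "set (\<Phi> e) \<subseteq> arcs \<Gamma>" if "e \<in> arcs \<Gamma>" for e using path[OF that] by blast
    then have "{(e', e). e \<in> arcs \<Gamma> \<and> e' \<in> set (\<Phi> e) \<and> e \<notin> arcs T \<and> e' \<notin> arcs T}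
        \<subseteq> recursive_edges G A ?N \<times> recursive_edges G A ?N"
      unfolding rec by blast
    then have "?r \<subseteq> recursive_edges G A ?N \<times> recursive_edges G A ?N"
      unfolding flow_less_def by (rule trancl_subset_Sigma)
    then show ?thesis using flow by (simp add: flow_function_def wf_strict_order_on_def)
  qed
  moreover have "\<exists>p. awalk g p (g \<otimes> a) \<and> length p \<le> k \<and>
      (\<forall>e'\<in>set p. (e' \<in> recursive_edges G A ?N \<and> (g, a) \<in> recursive_edges G A ?N \<and> (e', (g, a)) \<in> ?r)
        \<or> e' \<in> degenerate_edges G A ?N)" if "g \<in> carrier G" "a \<in> A" for g a
  proof (intro exI[of _ "\<Phi> (g, a)"] conjI ballI)
    have e: "(g, a) \<in> arcs \<Gamma>" using that by simp
    show "awalk g (\<Phi> (g, a)) (g \<otimes> a)" using path[OF e] by simp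
    then have arcs: "set (\<Phi> (g, a)) \<subseteq> arcs \<Gamma>" by blast
    show "length (\<Phi> (g, a)) \<le> k" using bound e by blast
    fix e' assume e': "e' \<in> set (\<Phi> (g, a))"
    show "(e' \<in> recursive_edges G A ?N \<and> (g, a) \<in> recursive_edges G A ?N \<and> (e', (g, a)) \<in> ?r)
        \<or> e' \<in> degenerate_edges G A ?N"
    proof (cases "e' \<in> arcs T")
      case False
      then have "(g, a) \<notin> arcs T" using tree_edge[OF _ e] e' by auto
      then have "(e', (g, a)) \<in> ?r" using False e e' unfolding flow_less_def by blast
      then show ?thesis using False \<open>(g, a) \<notin> arcs T\<close> e e' arcs unfolding rec by blast
    qed (simp add: deg)
  qed
  ultimately show ?thesis
    using tree_words_normal_forms[OF T] unfolding stackable_def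
    by (intro exI[of _ ?N] exI[of _ ?r] exI[of _ k] conjI ballI)
qed

end

theorem corollary3p2:
  fixes G :: "('a, 'm) monoid_scheme" and A :: "'a set"
  assumes "group G"
    and "finite A"
    and "symmetric_generating_set G A"
    and "\<one>\<^bsub>G\<^esub> \<notin> A"
  shows "stackable G A \<longleftrightarrow> admits_bounded_flow G A"
proof -
  interpret cayley G A
    using assms by (simp add: cayley_def cayley_axioms_def)
  show ?thesis using stackable_imp_bounded_flow bounded_flow_imp_stackable by blast
qed

end
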